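(* For any commutative partial monoid $M$ there is an equality of simplicial sets $B\hat{H}M_\bullet=BM_\bullet$, where elements $(x_S)_{S\subseteq[n]}$ of $\hat{H}M_n$ are identified with the $n$-tuples $(x_{\{1\}},\ldots,x_{\{n\}})$.
   Context: Plasmas. A plasma is a triple $(M,\boxplus,e)$ with $M$ a set, $\boxplus\colon M\times M\to\mathcal{P}(M)$ a function to the power set of $M$ and $e\in M$, such that $a\in e\boxplus a$ and $a\boxplus b=b\boxplus a$ for all $a,b\in M$. It is associative if $\bigcup_{x\in a\boxplus b}x\boxplus c=\bigcup_{x\in b\boxplus c}a\boxplus x$ for all $a,b,c$, and deterministic if every $a\boxplus b$ is empty or a singleton (then automatically $a\boxplus e=\{a\}$ for all $a$). A commutative partial monoid is a plasma $(M,\boxplus,0)$ that is associative and deterministic; when $a\boxplus b=\{c\}$ one says $a+b$ is defined and equals $c$, and a sum $m_1+\cdots+m_n$ is defined if the iterated hypersum is nonempty. $BM_\bullet$. For a partial monoid $M$, $BM_\bullet$ is the simplicial set with $BM_n=\{(m_1,\ldots,m_n)\in M^n: m_1+\cdots+m_n\text{ is defined in }M\}$, face maps $d_0(m_1,\ldots,m_n)=(m_2,\ldots,m_n)$, $d_i(m_1,\ldots,m_n)=(m_1,\ldots,m_i+m_{i+1},\ldots,m_n)$ for $0<i<n$, $d_n(m_1,\ldots,m_n)=(m_1,\ldots,m_{n-1})$, and degeneracies $s_i(m_1,\ldots,m_n)=(m_1,\ldots,m_i,0,m_{i+1},\ldots,m_n)$. $\hat{H}M$. $\mathsf{Fin}_\ast$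 is the category of pointed sets $\langle n\rangle=\{0,1,\ldots,n\}$ ($n\ge0$, basepoint $0$) and pointed functions; an $\mathbb{F}_1$-module is a functor $X\colon\mathsf{Fin}_\ast\to\mathsf{Set}_\ast$ to pointed sets with $X(\langle0\rangle)$ a singleton. With $[n]=\{1,\ldots,n\}$, $\hat{H}M$ is the $\mathbb{F}_1$-module $$\hat{H}M_n=\{(x_S)_{S\subseteq[n]}: x_S\in M,\ x_\varnothing=0,\ x_{S\cup T}\in x_S\boxplus x_T\text{ whenever }S\cap T=\varnothing\},$$ pointed by the constant family $0$, where $\phi\colon\langle n\rangle\to\langle m\rangle$ acts by $(x_S)_{S\subseteq[n]}\mapsto (x_{\phi^{-1}(T)})_{T\subseteq[m]}$. The functor $B$. For an $\mathbb{F}_1$-module $X$, $BX=X\circ\beta$ (forgetting basepoints), where $\beta\colon\Delta^{\mathrm{op}}\to\mathsf{Fin}_\ast$ sends the ordinal $\{0<1<\cdots<n\}$ to $\langle n\rangle$ and sends an order-preserving map $\phi\colon\{0<\cdots<m\}\to\{0<\cdots<n\}$ to the pointed map $\beta(\phi)\colon\langle n\rangle\to\langle m\rangle$ defined for $1\le i\le n$ by: with $K_i=\{j: i\le\phi(j)\}$, $\beta(\phi)(i)=\min K_i$ if $K_i\ne\varnothing$ and $0\notin K_i$, and $\beta(\phi)(i)=0$ otherwise. *)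

theory Defs
  imports Main "HOL-Library.FuncSet"
begin

section \<open>Plasmas and partial monoids\<close>

locale plasma =
  fixes M :: "'a set"
    and hsum :: "'a \<Rightarrow> 'a \<Rightarrow> 'a set" (infixl "\<boxplus>" 65)
    and e :: 'a
  assumes unit_mem: "e \<in> M"
    and hsum_subset: "\<lbrakk>a \<in> M; b \<in> M\<rbrakk> \<Longrightarrow> a \<boxplus> b \<subseteq> M"
    and unit_hsum: "a \<in> M \<Longrightarrow> a \<in> e \<boxplus> a"
    and hsum_commute: "\<lbrakk>a \<in> M; b \<in> M\<rbrakk> \<Longrightarrow> a \<boxplus> b = b \<boxplus> a"

locale associative_plasma = plasma +
  assumes hsum_assoc: "\<lbrakk>a \<in> M; b \<in> M; c \<in> M\<rbrakk> \<Longrightarrow>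
    (\<Union>x \<in> a \<boxplus> b. x \<boxplus> c) = (\<Union>x \<in> b \<boxplus> c. a \<boxplus> x)"

locale deterministic_plasma = plasma +
  assumes hsum_deterministic: "\<lbrakk>a \<in> M; b \<in> M\<rbrakk> \<Longrightarrow> a \<boxplus> b = {} \<or> (\<exists>c. a \<boxplus> b = {c})"

locale commutative_partial_monoid = associative_plasma + deterministic_plasma

text \<open>Iterated hypersums are bracketed to the left; the empty one is the singleton of the unit.\<close>

fun iterated_hsum :: "('a \<Rightarrow> 'a \<Rightarrow> 'a set) \<Rightarrow> 'a \<Rightarrow> 'a list \<Rightarrow> 'a set" where
  "iterated_hsum h e [] = {e}"
| "iterated_hsum h e (m # ms) = foldl (\<lambda>A b. \<Union>x\<in>A. h x b) {m} ms"

definition sum_defined :: "('a \<Rightarrow> 'a \<Rightarrow> 'a set) \<Rightarrow> 'a \<Rightarrow> 'a list \<Rightarrow> bool" where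
  "sum_defined h e ms \<longleftrightarrow> iterated_hsum h e ms \<noteq> {}"

text \<open>The value of a sum of two elements; only meaningful when that sum is defined.\<close>

definition partial_sum :: "('a \<Rightarrow> 'a \<Rightarrow> 'a set) \<Rightarrow> 'a \<Rightarrow> 'a \<Rightarrow> 'a" where
  "partial_sum h a b = the_elem (h a b)"


section \<open>Simplicial sets\<close>

text \<open>
  A simplicial set is given by its faces \<open>face X n i : X\<^sub>n \<rightarrow> X\<^sub>n\<^sub>-\<^sub>1\<close> (for \<open>n \<ge> 1\<close>, \<open>i \<le> n\<close>)
  and degeneracies \<open>degen X n i : X\<^sub>n \<rightarrow> X\<^sub>n\<^sub>+\<^sub>1\<close> (for \<open>i \<le> n\<close>).
\<close>

record 'x simplicial_data =
  simplices :: "nat \<Rightarrow> 'x set"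
  face :: "nat \<Rightarrow> nat \<Rightarrow> 'x \<Rightarrow> 'x"
  degen :: "nat \<Rightarrow> nat \<Rightarrow> 'x \<Rightarrow> 'x"

definition simplicial_set :: "'x simplicial_data \<Rightarrow> bool" where
  "simplicial_set X \<longleftrightarrow>
    (\<forall>n i. 1 \<le> n \<and> i \<le> n \<longrightarrow> face X n i \<in> simplices X n \<rightarrow> simplices X (n - 1)) \<and>
    (\<forall>n i. i \<le> n \<longrightarrow> degen X n i \<in> simplices X n \<rightarrow> simplices X (n + 1)) \<and>
    (\<forall>n i j. \<forall>x \<in> simplices X n. 2 \<le> n \<and> i < j \<and> j \<le> n \<longrightarrow>
      face X (n - 1) i (face X n j x) = face X (n - 1) (j - 1) (face X n i x)) \<and>
    (\<forall>n i j. \<forall>x \<in> simplices X n. i < j \<and> j \<le> n \<longrightarrow>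
      face X (n + 1) i (degen X n j x) = degen X (n - 1) (j - 1) (face X n i x)) \<and>
    (\<forall>n j. \<forall>x \<in> simplices X n. j \<le> n \<longrightarrow>
      face X (n + 1) j (degen X n j x) = x \<and> face X (n + 1) (j + 1) (degen X n j x) = x) \<and>
    (\<forall>n i j. \<forall>x \<in> simplices X n. j + 1 < i \<and> i \<le> n + 1 \<longrightarrow>
      face X (n + 1) i (degen X n j x) = degen X (n - 1) j (face X n (i - 1) x)) \<and>
    (\<forall>n i j. \<forall>x \<in> simplices X n. i \<le> j \<and> j \<le> n \<longrightarrow>
      degen X (n + 1) i (degen X n j x) = degen X (n + 1) (j + 1) (degen X n i x))"

definition simplicial_iso ::
  "'x simplicial_data \<Rightarrow> 'y simplicial_data \<Rightarrow> (nat \<Rightarrow> 'x \<Rightarrow> 'y) \<Rightarrow> bool" where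
  "simplicial_iso X Y f \<longleftrightarrow>
    simplicial_set X \<and> simplicial_set Y \<and>
    (\<forall>n. bij_betw (f n) (simplices X n) (simplices Y n)) \<and>
    (\<forall>n i. \<forall>x \<in> simplices X n. 1 \<le> n \<and> i \<le> n \<longrightarrow>
      f (n - 1) (face X n i x) = face Y n i (f n x)) \<and>
    (\<forall>n i. \<forall>x \<in> simplices X n. i \<le> n \<longrightarrow>
      f (n + 1) (degen X n i x) = degen Y n i (f n x))"

text \<open>
  The ordinal \<open>{0 < \<dots> < n}\<close> is \<open>{0..n}\<close>. Morphisms are extensional functions, so that equal
  morphisms are equal as HOL functions and composition is \<open>compose\<close>.
\<close>

definition Delta_hom :: "nat \<Rightarrow> nat \<Rightarrow> (nat \<Rightarrow> nat) set" where
  "Delta_hom m n = {\<phi> \<in> {0..m} \<rightarrow>\<^sub>E {0..n}. mono_on {0..m} \<phi>}"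

text \<open>
  For a functor \<open>X\<close> from the opposite of the simplex category to sets, a morphism
  \<open>\<phi> \<in> Delta_hom m n\<close> acts as \<open>pre_act X m n \<phi> : X\<^sub>n \<rightarrow> X\<^sub>m\<close>.
\<close>

record 'x presheaf_data =
  pre_set :: "nat \<Rightarrow> 'x set"
  pre_act :: "nat \<Rightarrow> nat \<Rightarrow> (nat \<Rightarrow> nat) \<Rightarrow> 'x \<Rightarrow> 'x"

definition Delta_presheaf :: "'x presheaf_data \<Rightarrow> bool" where
  "Delta_presheaf X \<longleftrightarrow>
    (\<forall>m n. \<forall>\<phi> \<in> Delta_hom m n. pre_act X m n \<phi> \<in> pre_set X n \<rightarrow> pre_set X m) \<and>
    (\<forall>n. \<forall>x \<in> pre_set X n. pre_act X n n (\<lambda>i \<in> {0..n}. i) x = x) \<and>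
    (\<forall>l m n. \<forall>\<phi> \<in> Delta_hom l m. \<forall>\<psi> \<in> Delta_hom m n. \<forall>x \<in> pre_set X n.
      pre_act X l n (compose {0..l} \<psi> \<phi>) x = pre_act X l m \<phi> (pre_act X m n \<psi> x))"

text \<open>
  \<open>coface n i\<close> is the injection from \<open>{0..n-1}\<close> to \<open>{0..n}\<close> omitting \<open>i\<close>, and \<open>codegen n i\<close> the
  surjection from \<open>{0..n+1}\<close> to \<open>{0..n}\<close> taking the value \<open>i\<close> twice.
\<close>

definition coface :: "nat \<Rightarrow> nat \<Rightarrow> nat \<Rightarrow> nat" where
  "coface n i = (\<lambda>j \<in> {0..n-1}. if j < i then j else j + 1)"

definition codegen :: "nat \<Rightarrow> nat \<Rightarrow> nat \<Rightarrow> nat" where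
  "codegen n i = (\<lambda>j \<in> {0..n+1}. if j \<le> i then j else j - 1)"

definition simplicial_of_presheaf :: "'x presheaf_data \<Rightarrow> 'x simplicial_data" where
  "simplicial_of_presheaf X =
    \<lparr> simplices = pre_set X,
      face = (\<lambda>n i. pre_act X (n - 1) n (coface n i)),
      degen = (\<lambda>n i. pre_act X (n + 1) n (codegen n i)) \<rparr>"


section \<open>The bar construction of a partial monoid\<close>

text \<open>A tuple \<open>(m\<^sub>1, \<dots>, m\<^sub>n)\<close> is a list, in which \<open>m\<^sub>i\<close> has index \<open>i - 1\<close>.\<close>

definition BM :: "'a set \<Rightarrow> ('a \<Rightarrow> 'a \<Rightarrow> 'a set) \<Rightarrow> 'a \<Rightarrow> 'a list simplicial_data" where
  "BM M h e =
    \<lparr> simplices = (\<lambda>n. {ms. length ms = n \<and> set ms \<subseteq> M \<and> sum_defined h e ms}),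
      face = (\<lambda>n i ms.
        if i = 0 then tl ms
        else if i = n then butlast ms
        else take (i - 1) ms @ [partial_sum h (ms ! (i - 1)) (ms ! i)] @ drop (i + 1) ms),
      degen = (\<lambda>n i ms. take i ms @ [e] @ drop i ms) \<rparr>"


section \<open>Modules over the field with one element\<close>

text \<open>The pointed set \<open>\<langle>n\<rangle>\<close> is \<open>{0..n}\<close> with basepoint \<open>0\<close>.\<close>

definition Fin_hom :: "nat \<Rightarrow> nat \<Rightarrow> (nat \<Rightarrow> nat) set" where
  "Fin_hom n m = {\<phi> \<in> {0..n} \<rightarrow>\<^sub>E {0..m}. \<phi> 0 = 0}"

record 'x F1_data =
  F1_set :: "nat \<Rightarrow> 'x set"
  F1_base :: "nat \<Rightarrow> 'x"
  F1_act :: "nat \<Rightarrow> nat \<Rightarrow> (nat \<Rightarrow> nat) \<Rightarrow> 'x \<Rightarrow> 'x"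

definition F1_module :: "'x F1_data \<Rightarrow> bool" where
  "F1_module X \<longleftrightarrow>
    (\<forall>n. F1_base X n \<in> F1_set X n) \<and>
    F1_set X 0 = {F1_base X 0} \<and>
    (\<forall>n m. \<forall>\<phi> \<in> Fin_hom n m.
      F1_act X n m \<phi> \<in> F1_set X n \<rightarrow> F1_set X m \<and> F1_act X n m \<phi> (F1_base X n) = F1_base X m) \<and>
    (\<forall>n. \<forall>x \<in> F1_set X n. F1_act X n n (\<lambda>i \<in> {0..n}. i) x = x) \<and>
    (\<forall>n m l. \<forall>\<phi> \<in> Fin_hom n m. \<forall>\<psi> \<in> Fin_hom m l. \<forall>x \<in> F1_set X n.
      F1_act X n l (compose {0..n} \<psi> \<phi>) x = F1_act X m l \<psi> (F1_act X n m \<phi> x))"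

text \<open>
  A family \<open>(x\<^sub>S)\<close> indexed by the subsets of \<open>{1..n}\<close> is a function on sets which is
  \<open>undefined\<close> outside \<open>Pow {1..n}\<close>.
\<close>

definition Hhat :: "'a set \<Rightarrow> ('a \<Rightarrow> 'a \<Rightarrow> 'a set) \<Rightarrow> 'a \<Rightarrow> (nat set \<Rightarrow> 'a) F1_data" where
  "Hhat M h e =
    \<lparr> F1_set = (\<lambda>n. {x \<in> Pow {1..n} \<rightarrow>\<^sub>E M. x {} = e \<and>
        (\<forall>S T. S \<subseteq> {1..n} \<and> T \<subseteq> {1..n} \<and> S \<inter> T = {} \<longrightarrow> x (S \<union> T) \<in> h (x S) (x T))}),
      F1_base = (\<lambda>n. \<lambda>S \<in> Pow {1..n}. e),
      F1_act = (\<lambda>n m \<phi> x. \<lambda>T \<in> Pow {1..m}. x (\<phi> -` T \<inter> {0..n})) \<rparr>"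


section \<open>The functor from modules to simplicial sets\<close>

definition beta :: "nat \<Rightarrow> nat \<Rightarrow> (nat \<Rightarrow> nat) \<Rightarrow> nat \<Rightarrow> nat" where
  "beta m n \<phi> = (\<lambda>i \<in> {0..n}.
    let K = {j \<in> {0..m}. i \<le> \<phi> j}
    in if 1 \<le> i \<and> K \<noteq> {} \<and> 0 \<notin> K then Min K else 0)"

definition B_presheaf :: "'x F1_data \<Rightarrow> 'x presheaf_data" where
  "B_presheaf X =
    \<lparr> pre_set = F1_set X,
      pre_act = (\<lambda>m n \<phi>. F1_act X n m (beta m n \<phi>)) \<rparr>"

lemma beta_eq_iff:
  assumes "\<phi> \<in> Delta_hom m n" "i \<in> {1..n}" "j \<in> {1..m}"
  shows "beta m n \<phi> i = j \<longleftrightarrow> i \<le> \<phi> j \<and> \<phi> (j - 1) < i"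
proof -
  have mono: "\<phi> a \<le> \<phi> b" if "a \<le> b" "b \<le> m" for a b
    using assms(1) that by (auto simp: Delta_hom_def mono_on_def)
  define K where "K = {j \<in> {0..m}. i \<le> \<phi> j}"
  have "beta m n \<phi> i = (if 1 \<le> i \<and> K \<noteq> {} \<and> 0 \<notin> K then Min K else 0)"
    unfolding beta_def Let_def K_def using assms(2) by (subst restrict_apply, subst if_P) simp_all
  then have b: "beta m n \<phi> i = (if K \<noteq> {} \<and> 0 \<notin> K then Min K else 0)"
    using assms(2) by simp
  have fin: "finite K" by (simp add: K_def)
  show ?thesis
  proof
    assume eq: "beta m n \<phi> i = j"
    then have K: "K \<noteq> {}" "Min K = j" using b assms(3) by (auto split: if_splits)
    then have "j \<in> K" using fin Min_in by blast
    moreover have "j - 1 \<notin> K"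
    proof
      assume "j - 1 \<in> K"
      then have "Min K \<le> j - 1" using fin by simp
      then have "j \<le> j - 1" using K by simp
      then show False using assms(3) by auto
    qed
    ultimately show "i \<le> \<phi> j \<and> \<phi> (j - 1) < i" using assms(3) by (auto simp: K_def)
  next
    assume r: "i \<le> \<phi> j \<and> \<phi> (j - 1) < i"
    have "j \<in> K" using r assms(3) by (simp add: K_def)
    moreover have "j \<le> k" if "k \<in> K" for k
    proof (rule ccontr)
      assume "\<not> j \<le> k"
      then have "\<phi> k \<le> \<phi> (j - 1)" using assms(3) by (intro mono) auto
      then show False using that r by (simp add: K_def)
    qed
    ultimately have "Min K = j" using fin by (auto intro: Min_eqI)
    moreover have "0 \<notin> K" using \<open>\<And>k. k \<in> K \<Longrightarrow> j \<le> k\<close> assms(3) by force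
    ultimately show "beta m n \<phi> i = j" using b \<open>j \<in> K\<close> by auto
  qed
qed

lemma beta_Fin_hom:
  assumes "\<phi> \<in> Delta_hom m n"
  shows "beta m n \<phi> \<in> Fin_hom n m"
proof -
  have "beta m n \<phi> i \<le> m" if "i \<le> n" for i
  proof -
    define K where "K = {j \<in> {0..m}. i \<le> \<phi> j}"
    have "finite K" by (simp add: K_def)
    then have "K \<noteq> {} \<Longrightarrow> Min K \<in> K" by (rule Min_in)
    then show ?thesis using that by (auto simp: beta_def Let_def K_def)
  qed
  then show ?thesis by (auto simp: Fin_hom_def beta_def)
qed

lemma beta_id: "beta n n (\<lambda>i \<in> {0..n}. i) = (\<lambda>i \<in> {0..n}. i)"
proof
  fix i
  have h: "(\<lambda>i \<in> {0..n}. i) \<in> Delta_hom n n" by (auto simp: Delta_hom_def mono_on_def)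
  show "beta n n (\<lambda>i \<in> {0..n}. i) i = (\<lambda>i \<in> {0..n}. i) i"
  proof (cases "i \<in> {1..n}")
    case True
    then show ?thesis using beta_eq_iff[OF h True True] by auto
  qed (auto simp: beta_def)
qed

lemma beta_compose:
  assumes f: "\<phi> \<in> Delta_hom l m" and g: "\<psi> \<in> Delta_hom m n"
  shows "beta l n (compose {0..l} \<psi> \<phi>) = compose {0..n} (beta l m \<phi>) (beta m n \<psi>)"
proof
  fix i
  have fm: "\<And>a. a \<le> l \<Longrightarrow> \<phi> a \<le> m" "\<And>a b. \<lbrakk>a \<le> b; b \<le> l\<rbrakk> \<Longrightarrow> \<phi> a \<le> \<phi> b"
    using f by (auto simp: Delta_hom_def mono_on_def)
  have gm: "\<And>a. a \<le> m \<Longrightarrow> \<psi> a \<le> n" "\<And>a b. \<lbrakk>a \<le> b; b \<le> m\<rbrakk> \<Longrightarrow> \<psi> a \<le> \<psi> b"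
    using g by (auto simp: Delta_hom_def mono_on_def)
  have c: "compose {0..l} \<psi> \<phi> \<in> Delta_hom l n"
    using fm gm by (auto simp: Delta_hom_def mono_on_def compose_def)
  have bf: "\<And>a. a \<le> m \<Longrightarrow> beta l m \<phi> a \<le> l" "beta l m \<phi> 0 = 0"
    using beta_Fin_hom[OF f] by (auto simp: Fin_hom_def)
  have bg: "\<And>a. a \<le> n \<Longrightarrow> beta m n \<psi> a \<le> m"
    using beta_Fin_hom[OF g] by (auto simp: Fin_hom_def)
  have bc: "\<And>a. a \<le> n \<Longrightarrow> beta l n (compose {0..l} \<psi> \<phi>) a \<le> l"
    using beta_Fin_hom[OF c] by (auto simp: Fin_hom_def)
  show "beta l n (compose {0..l} \<psi> \<phi>) i = compose {0..n} (beta l m \<phi>) (beta m n \<psi>) i"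
  proof (cases "i \<in> {1..n}")
    case i: True
    have key: "beta l n (compose {0..l} \<psi> \<phi>) i = j \<longleftrightarrow> beta l m \<phi> (beta m n \<psi> i) = j"
      if j: "j \<in> {1..l}" for j
    proof -
      have L: "beta l n (compose {0..l} \<psi> \<phi>) i = j \<longleftrightarrow> i \<le> \<psi> (\<phi> j) \<and> \<psi> (\<phi> (j - 1)) < i"
        using beta_eq_iff[OF c i j] j by (auto simp: compose_def)
      show ?thesis
      proof
        assume "beta l n (compose {0..l} \<psi> \<phi>) i = j"
        then have r: "i \<le> \<psi> (\<phi> j)" "\<psi> (\<phi> (j - 1)) < i" using L by auto
        define k where "k = (LEAST k. i \<le> \<psi> k)"
        have k1: "i \<le> \<psi> k" unfolding k_def using r(1) by (rule LeastI)
        have k2: "k \<le> \<phi> j" unfolding k_def using r(1) by (rule Least_le)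
        have k3: "\<phi> (j - 1) < k"
        proof (rule ccontr)
          assume "\<not> \<phi> (j - 1) < k"
          then have "\<psi> k \<le> \<psi> (\<phi> (j - 1))" using j by (intro gm(2) fm(1)) auto
          then show False using k1 r by linarith
        qed
        have k4: "\<psi> (k - 1) < i"
          using not_less_Least[of "k - 1" "\<lambda>k. i \<le> \<psi> k"] k3 by (simp add: k_def)
        have kin: "k \<in> {1..m}" using k2 k3 fm(1)[of j] j by auto
        have "beta m n \<psi> i = k" using beta_eq_iff[OF g i kin] k1 k4 by simp
        moreover have "beta l m \<phi> k = j" using beta_eq_iff[OF f kin j] k2 k3 by simp
        ultimately show "beta l m \<phi> (beta m n \<psi> i) = j" by simp
      next
        assume eq: "beta l m \<phi> (beta m n \<psi> i) = j"
        define k where "k = beta m n \<psi> i"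
        have "k \<noteq> 0"
        proof
          assume "k = 0"
          then show False using eq bf(2) j by (simp add: k_def)
        qed
        then have kin: "k \<in> {1..m}" using bg[of i] i by (auto simp: k_def)
        have a: "i \<le> \<psi> k" "\<psi> (k - 1) < i" using beta_eq_iff[OF g i kin] by (auto simp: k_def)
        have b: "k \<le> \<phi> j" "\<phi> (j - 1) < k" using beta_eq_iff[OF f kin j] eq by (auto simp: k_def)
        have "\<psi> k \<le> \<psi> (\<phi> j)" using b j by (intro gm(2) fm(1)) auto
        moreover have "\<psi> (\<phi> (j - 1)) \<le> \<psi> (k - 1)" using b kin by (intro gm(2)) auto
        ultimately show "beta l n (compose {0..l} \<psi> \<phi>) i = j" using L a by linarith
      qed
    qed
    have x: "beta l n (compose {0..l} \<psi> \<phi>) i \<le> l" using bc i by simp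
    have y: "beta l m \<phi> (beta m n \<psi> i) \<le> l" using bf bg i by simp
    have "beta l n (compose {0..l} \<psi> \<phi>) i = beta l m \<phi> (beta m n \<psi> i)"
    proof (cases "beta l n (compose {0..l} \<psi> \<phi>) i = 0")
      case True
      then show ?thesis
        using key[of "beta l m \<phi> (beta m n \<psi> i)"] y by (cases "beta l m \<phi> (beta m n \<psi> i) = 0") auto
    next
      case False
      then show ?thesis using key[of "beta l n (compose {0..l} \<psi> \<phi>) i"] x by auto
    qed
    then show ?thesis using i by (simp add: compose_def)
  next
    case False
    then show ?thesis by (auto simp: beta_def compose_def)
  qed
qed

lemma B_presheaf_functor:
  assumes X: "F1_module X"
  shows "Delta_presheaf (B_presheaf X)"
proof -
  note X' = X[unfolded F1_module_def]
  show ?thesis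
    unfolding Delta_presheaf_def B_presheaf_def presheaf_data.simps
  proof (intro conjI allI ballI)
    fix m n \<phi> assume h: "\<phi> \<in> Delta_hom m n"
    show "F1_act X n m (beta m n \<phi>) \<in> F1_set X n \<rightarrow> F1_set X m"
      using X'[THEN conjunct2, THEN conjunct2, THEN conjunct1] beta_Fin_hom[OF h] by blast
  next
    fix n x assume "x \<in> F1_set X n"
    then show "F1_act X n n (beta n n (\<lambda>i \<in> {0..n}. i)) x = x"
      using X'[THEN conjunct2, THEN conjunct2, THEN conjunct2, THEN conjunct1]
      unfolding beta_id by blast
  next
    fix l m n \<phi> \<psi> x
    assume h: "\<phi> \<in> Delta_hom l m" "\<psi> \<in> Delta_hom m n" "x \<in> F1_set X n"
    show "F1_act X n l (beta l n (compose {0..l} \<psi> \<phi>)) x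
      = F1_act X m l (beta l m \<phi>) (F1_act X n m (beta m n \<psi>) x)"
      unfolding beta_compose[OF h(1,2)]
      by (rule X'[THEN conjunct2, THEN conjunct2, THEN conjunct2, THEN conjunct2,
            rule_format, OF beta_Fin_hom[OF h(2)] beta_Fin_hom[OF h(1)] h(3)])
  qed
qed

lemma (in plasma) Hhat_F1_module:
  assumes "e \<boxplus> e = {e} \<or> True"
  shows "F1_module (Hhat M hsum e)"
proof -
  have vim: "\<phi> -` T \<inter> {0..n} \<subseteq> {1..n}" if "\<phi> \<in> Fin_hom n m" "T \<subseteq> {1..m}" for \<phi> n m T
  proof
    fix i assume i: "i \<in> \<phi> -` T \<inter> {0..n}"
    then have "i \<noteq> 0" using that by (auto simp: Fin_hom_def intro: ccontr)
    then show "i \<in> {1..n}" using i by simp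
  qed
  have act: "F1_act (Hhat M hsum e) n m \<phi> x \<in> F1_set (Hhat M hsum e) m"
    if p: "\<phi> \<in> Fin_hom n m" and x: "x \<in> F1_set (Hhat M hsum e) n" for n m \<phi> x
  proof -
    have xM: "x S \<in> M" if "S \<subseteq> {1..n}" for S using x that by (auto simp: Hhat_def)
    have xs: "x (S \<union> T) \<in> x S \<boxplus> x T" if "S \<subseteq> {1..n}" "T \<subseteq> {1..n}" "S \<inter> T = {}" for S T
      using x that by (auto simp: Hhat_def)
    have "x (\<phi> -` (S \<union> T) \<inter> {0..n}) \<in> x (\<phi> -` S \<inter> {0..n}) \<boxplus> x (\<phi> -` T \<inter> {0..n})"
      if "S \<subseteq> {1..m}" "T \<subseteq> {1..m}" "S \<inter> T = {}" for S T
    proof -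
      have "\<phi> -` (S \<union> T) \<inter> {0..n} = (\<phi> -` S \<inter> {0..n}) \<union> (\<phi> -` T \<inter> {0..n})" by auto
      moreover have "(\<phi> -` S \<inter> {0..n}) \<inter> (\<phi> -` T \<inter> {0..n}) = {}" using that by auto
      ultimately show ?thesis using xs[OF vim[OF p that(1)] vim[OF p that(2)]] by simp
    qed
    then show ?thesis using x xM vim[OF p] by (auto simp: Hhat_def)
  qed
  have cmp: "F1_act (Hhat M hsum e) n l (compose {0..n} \<psi> \<phi>) x
      = F1_act (Hhat M hsum e) m l \<psi> (F1_act (Hhat M hsum e) n m \<phi> x)"
    if p: "\<phi> \<in> Fin_hom n m" and q: "\<psi> \<in> Fin_hom m l" for n m l \<phi> \<psi> x
  proof
    fix T
    have "compose {0..n} \<psi> \<phi> -` T \<inter> {0..n} = \<phi> -` (\<psi> -` T \<inter> {0..m}) \<inter> {0..n}"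
      using p by (auto simp: compose_def Fin_hom_def)
    then show "F1_act (Hhat M hsum e) n l (compose {0..n} \<psi> \<phi>) x T
      = F1_act (Hhat M hsum e) m l \<psi> (F1_act (Hhat M hsum e) n m \<phi> x) T"
      using vim[OF q, of T] by (auto simp: Hhat_def)
  qed
  have ident: "F1_act (Hhat M hsum e) n n (\<lambda>i \<in> {0..n}. i) x = x"
    if x: "x \<in> F1_set (Hhat M hsum e) n" for n x
  proof
    fix T
    have ext: "x T = undefined" if "T \<notin> Pow {1..n}"
      using x that by (auto simp: Hhat_def intro: PiE_arb)
    show "F1_act (Hhat M hsum e) n n (\<lambda>i \<in> {0..n}. i) x T = x T"
    proof (cases "T \<subseteq> {1..n}")
      case True
      then have "(\<lambda>i \<in> {0..n}. i) -` T \<inter> {0..n} = T" by fastforce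
      then show ?thesis using True by (simp add: Hhat_def)
    next
      case False
      then show ?thesis using ext by (simp add: Hhat_def)
    qed
  qed
  have base: "F1_base (Hhat M hsum e) n \<in> F1_set (Hhat M hsum e) n" for n
    using unit_mem unit_hsum by (auto simp: Hhat_def)
  have zero: "F1_set (Hhat M hsum e) 0 = {F1_base (Hhat M hsum e) 0}"
  proof (rule equalityI; rule subsetI)
    fix x assume x: "x \<in> F1_set (Hhat M hsum e) 0"
    have "x T = F1_base (Hhat M hsum e) 0 T" for T
    proof (cases "T = {}")
      case True
      then show ?thesis using x by (simp add: Hhat_def)
    next
      case False
      then show ?thesis using x by (auto simp: Hhat_def PiE_def extensional_def)
    qed
    then show "x \<in> {F1_base (Hhat M hsum e) 0}" by auto
  qed (use base in simp)
  have bact: "F1_act (Hhat M hsum e) n m \<phi> (F1_base (Hhat M hsum e) n) = F1_base (Hhat M hsum e) m"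
    if "\<phi> \<in> Fin_hom n m" for n m \<phi>
  proof
    fix T
    show "F1_act (Hhat M hsum e) n m \<phi> (F1_base (Hhat M hsum e) n) T = F1_base (Hhat M hsum e) m T"
      using vim[OF that, of T] by (simp add: Hhat_def)
  qed
  show ?thesis
    unfolding F1_module_def
    by (intro conjI allI ballI funcsetI base zero ident cmp act bact; assumption)
qed

end

theory Submission
  imports Defs "HOL-Algebra.FiniteProduct"
begin

text \<open>
  An element of degree \<open>n\<close> of \<open>Hhat M\<close> is a family \<open>x\<close> on the subsets of \<open>{1..n}\<close> that is additive on
  disjoint unions. Since sums in a partial monoid have at most one value, additivity leaves no choice
  beyond the values on singletons: \<open>x S\<close> is the sum of the \<open>x {i}\<close> with \<open>i \<in> S\<close>, and in particular
  the total sum is defined. Conversely, if \<open>m\<^sub>1 + \<dots> + m\<^sub>n\<close> is defined, then associativity and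
  commutativity make every subsum defined, and the subsums form an additive family. This is the
  bijection \<open>bij_betw_Hhat_BM\<close>.

  To handle sums that may be undefined, and to reorder them freely, the sums are computed in the
  power set of \<open>M\<close>. With \<open>A + B\<close> the union of all \<open>a \<boxplus> b\<close>, it is a commutative monoid in which the
  empty set plays the part of the undefined value. An iterated hypersum is then a finite product of
  singletons (\<open>iterated_hsum_eq_hsum_over\<close>), so the general theory of finite products in commutative
  monoids applies.

  A monotone map \<open>\<phi>\<close> sends an additive family \<open>x\<close> to the one whose \<open>j\<close>-th singleton value is the value
  of \<open>x\<close> on the block \<open>{\<phi> (j - 1)<..\<phi> j}\<close>. For a coface the blocks are singletons, except possibly for
  one block of two neighbours, whose value is their sum; for a codegeneracy they are singletons and
  one empty block, whose value is the unit. These are the faces and degeneracies of the bar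
  construction (\<open>Hhat_face\<close>, \<open>Hhat_degen\<close>). Its simplicial identities need no computation with lists:
  they are carried over along the bijection from \<open>Hhat M\<close>, where they hold by functoriality.
\<close>


section \<open>Simplicial sets from presheaves, and transport along bijections\<close>

lemma coface_Delta_hom: "1 \<le> n \<Longrightarrow> i \<le> n \<Longrightarrow> coface n i \<in> Delta_hom (n - 1) n"
  by (auto simp: coface_def Delta_hom_def mono_on_def)

lemma codegen_Delta_hom: "i \<le> n \<Longrightarrow> codegen n i \<in> Delta_hom (n + 1) n"
  by (auto simp: codegen_def Delta_hom_def mono_on_def)

text \<open>
  The lemmas from here up to \<open>codegen_codegen\<close> are the cosimplicial identities; by contravariance,
  they yield the simplicial identities in \<open>simplicial_set_of_presheaf\<close>.
\<close>

lemma coface_coface: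
  assumes "i < j" "j \<le> n"
  shows "compose {0..n - 2} (coface n j) (coface (n - 1) i)
    = compose {0..n - 2} (coface n i) (coface (n - 1) (j - 1))"
  using assms by (intro ext) (auto simp: compose_def coface_def)

lemma codegen_coface_below:
  assumes "i < j" "j \<le> n"
  shows "compose {0..n} (codegen n j) (coface (n + 1) i)
    = compose {0..n} (coface n i) (codegen (n - 1) (j - 1))"
  using assms by (intro ext) (auto simp: compose_def coface_def codegen_def)

lemma codegen_coface_left: "compose {0..n} (codegen n j) (coface (n + 1) j) = (\<lambda>k\<in>{0..n}. k)"
  by (intro ext) (auto simp: compose_def coface_def codegen_def)

lemma codegen_coface_right:
  "compose {0..n} (codegen n j) (coface (n + 1) (j + 1)) = (\<lambda>k\<in>{0..n}. k)"
  by (intro ext) (auto simp: compose_def coface_def codegen_def)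

lemma codegen_coface_above:
  assumes "j + 1 < i" "i \<le> n + 1"
  shows "compose {0..n} (codegen n j) (coface (n + 1) i)
    = compose {0..n} (coface n (i - 1)) (codegen (n - 1) j)"
  using assms by (intro ext) (auto simp: compose_def coface_def codegen_def)

lemma codegen_codegen:
  assumes "i \<le> j" "j \<le> n"
  shows "compose {0..n + 2} (codegen n j) (codegen (n + 1) i)
    = compose {0..n + 2} (codegen n i) (codegen (n + 1) (j + 1))"
  using assms by (intro ext) (auto simp: compose_def codegen_def)

lemma simplicial_set_of_presheaf:
  assumes X: "Delta_presheaf X"
  shows "simplicial_set (simplicial_of_presheaf X)"
proof -
  have act: "pre_act X m n \<phi> \<in> pre_set X n \<rightarrow> pre_set X m" if "\<phi> \<in> Delta_hom m n" for m n \<phi>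
    using X that unfolding Delta_presheaf_def by blast
  have act_id: "pre_act X n n (\<lambda>k\<in>{0..n}. k) x = x" if "x \<in> pre_set X n" for n x
    using X that unfolding Delta_presheaf_def by blast
  have act_comp: "pre_act X l m \<phi> (pre_act X m n \<psi> x) = pre_act X l n (compose {0..l} \<psi> \<phi>) x"
    if "\<phi> \<in> Delta_hom l m" "\<psi> \<in> Delta_hom m n" "x \<in> pre_set X n" for l m n \<phi> \<psi> x
    using X that unfolding Delta_presheaf_def by metis
  have face: "pre_act X (n - 1) n (coface n i) \<in> pre_set X n \<rightarrow> pre_set X (n - 1)"
    if "1 \<le> n" "i \<le> n" for n i
    using act coface_Delta_hom that by blast
  have degen: "pre_act X (n + 1) n (codegen n i) \<in> pre_set X n \<rightarrow> pre_set X (n + 1)"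
    if "i \<le> n" for n i
    using act codegen_Delta_hom that by blast
  have ff: "pre_act X (n - 1 - 1) (n - 1) (coface (n - 1) i) (pre_act X (n - 1) n (coface n j) x)
      = pre_act X (n - 1 - 1) (n - 1) (coface (n - 1) (j - 1)) (pre_act X (n - 1) n (coface n i) x)"
    if "x \<in> pre_set X n" "2 \<le> n" "i < j" "j \<le> n" for n i j x
  proof -
    have "n - 1 - 1 = n - 2" by simp
    moreover have "coface (n - 1) i \<in> Delta_hom (n - 1 - 1) (n - 1)"
      "coface (n - 1) (j - 1) \<in> Delta_hom (n - 1 - 1) (n - 1)"
      "coface n i \<in> Delta_hom (n - 1) n" "coface n j \<in> Delta_hom (n - 1) n"
      using that by (intro coface_Delta_hom; simp)+
    ultimately show ?thesis
      using that(1) coface_coface[OF that(3,4)] by (simp add: act_comp)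
  qed
  have below: "pre_act X (n + 1 - 1) (n + 1) (coface (n + 1) i) (pre_act X (n + 1) n (codegen n j) x)
      = pre_act X (n - 1 + 1) (n - 1) (codegen (n - 1) (j - 1)) (pre_act X (n - 1) n (coface n i) x)"
    if "x \<in> pre_set X n" "i < j" "j \<le> n" for n i j x
  proof -
    have "n + 1 - 1 = n" "n - 1 + 1 = n" using that by simp_all
    moreover have "coface (n + 1) i \<in> Delta_hom (n + 1 - 1) (n + 1)"
      "coface n i \<in> Delta_hom (n - 1) n"
      "codegen (n - 1) (j - 1) \<in> Delta_hom (n - 1 + 1) (n - 1)"
      "codegen n j \<in> Delta_hom (n + 1) n"
      using that by (intro coface_Delta_hom codegen_Delta_hom; simp)+
    ultimately show ?thesis
      using that(1) codegen_coface_below[OF that(2,3)] by (simp add: act_comp)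
  qed
  have id1: "pre_act X (n + 1 - 1) (n + 1) (coface (n + 1) j) (pre_act X (n + 1) n (codegen n j) x) = x"
    if "x \<in> pre_set X n" "j \<le> n" for n j x
  proof -
    have "n + 1 - 1 = n" by simp
    moreover have "coface (n + 1) j \<in> Delta_hom (n + 1 - 1) (n + 1)" "codegen n j \<in> Delta_hom (n + 1) n"
      using that by (intro coface_Delta_hom codegen_Delta_hom; simp)+
    ultimately show ?thesis
      using that(1) codegen_coface_left[of n j] by (simp add: act_comp act_id)
  qed
  have id2: "pre_act X (n + 1 - 1) (n + 1) (coface (n + 1) (j + 1)) (pre_act X (n + 1) n (codegen n j) x) = x"
    if "x \<in> pre_set X n" "j \<le> n" for n j x
  proof -
    have "n + 1 - 1 = n" by simp
    moreover have "coface (n + 1) (j + 1) \<in> Delta_hom (n + 1 - 1) (n + 1)" "codegen n j \<in> Delta_hom (n + 1) n"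
      using that by (intro coface_Delta_hom codegen_Delta_hom; simp)+
    ultimately show ?thesis
      using that(1) codegen_coface_right[of n j] by (simp add: act_comp act_id)
  qed
  have above: "pre_act X (n + 1 - 1) (n + 1) (coface (n + 1) i) (pre_act X (n + 1) n (codegen n j) x)
      = pre_act X (n - 1 + 1) (n - 1) (codegen (n - 1) j) (pre_act X (n - 1) n (coface n (i - 1)) x)"
    if "x \<in> pre_set X n" "j + 1 < i" "i \<le> n + 1" for n i j x
  proof -
    have "n + 1 - 1 = n" "n - 1 + 1 = n" using that by simp_all
    moreover have "coface (n + 1) i \<in> Delta_hom (n + 1 - 1) (n + 1)"
      "coface n (i - 1) \<in> Delta_hom (n - 1) n"
      "codegen (n - 1) j \<in> Delta_hom (n - 1 + 1) (n - 1)"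
      "codegen n j \<in> Delta_hom (n + 1) n"
      using that by (intro coface_Delta_hom codegen_Delta_hom; simp)+
    ultimately show ?thesis
      using that(1) codegen_coface_above[OF that(2,3)] by (simp add: act_comp)
  qed
  have dd: "pre_act X (n + 1 + 1) (n + 1) (codegen (n + 1) i) (pre_act X (n + 1) n (codegen n j) x)
      = pre_act X (n + 1 + 1) (n + 1) (codegen (n + 1) (j + 1)) (pre_act X (n + 1) n (codegen n i) x)"
    if "x \<in> pre_set X n" "i \<le> j" "j \<le> n" for n i j x
  proof -
    have "n + 1 + 1 = n + 2" by simp
    moreover have "codegen (n + 1) i \<in> Delta_hom (n + 1 + 1) (n + 1)"
      "codegen (n + 1) (j + 1) \<in> Delta_hom (n + 1 + 1) (n + 1)"
      "codegen n i \<in> Delta_hom (n + 1) n" "codegen n j \<in> Delta_hom (n + 1) n"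
      using that by (intro codegen_Delta_hom; simp)+
    ultimately show ?thesis
      using that(1) codegen_codegen[OF that(2,3)] by (simp add: act_comp)
  qed
  show ?thesis
    unfolding simplicial_set_def simplicial_of_presheaf_def simplicial_data.simps
    by (intro conjI allI ballI impI; (elim conjE)?;
        (rule face | rule degen | rule ff | rule below | rule id1 | rule id2 | rule above | rule dd);
        assumption)
qed

text \<open>
  A degreewise bijection that commutes with the operators conjugates those of \<open>X\<close> into those of
  \<open>Y\<close>, so every identity that holds in \<open>X\<close> holds in \<open>Y\<close>. Thus only the source of the isomorphism
  has to be known to be a simplicial set.
\<close>

lemma simplicial_iso_transport:
  assumes X: "simplicial_set X"
    and bij: "\<And>n. bij_betw (f n) (simplices X n) (simplices Y n)"
    and face: "\<And>n i x. \<lbrakk>x \<in> simplices X n; 1 \<le> n; i \<le> n\<rbrakk> \<Longrightarrow>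
      f (n - 1) (face X n i x) = face Y n i (f n x)"
    and degen: "\<And>n i x. \<lbrakk>x \<in> simplices X n; i \<le> n\<rbrakk> \<Longrightarrow>
      f (n + 1) (degen X n i x) = degen Y n i (f n x)"
  shows "simplicial_iso X Y f"
proof -
  note X' = X[unfolded simplicial_set_def]
  note X_face = X'[THEN conjunct1, rule_format]
  note X_degen = X'[THEN conjunct2, THEN conjunct1, rule_format]
  note X_face_face = X'[THEN conjunct2, THEN conjunct2, THEN conjunct1, rule_format]
  note X_below = X'[THEN conjunct2, THEN conjunct2, THEN conjunct2, THEN conjunct1, rule_format]
  note X_same = X'[THEN conjunct2, THEN conjunct2, THEN conjunct2, THEN conjunct2, THEN conjunct1, rule_format]
  note X_above = X'[THEN conjunct2, THEN conjunct2, THEN conjunct2, THEN conjunct2, THEN conjunct2, THEN conjunct1, rule_format]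
  note X_degen_degen = X'[THEN conjunct2, THEN conjunct2, THEN conjunct2, THEN conjunct2, THEN conjunct2, THEN conjunct2, rule_format]
  have Xface: "face X n i x \<in> simplices X (n - 1)" if "x \<in> simplices X n" "1 \<le> n" "i \<le> n" for n i x
    using X_face[of n i] that by auto
  have Xdegen: "degen X n i x \<in> simplices X (n + 1)" if "x \<in> simplices X n" "i \<le> n" for n i x
    using X_degen[of i n] that by auto
  have img: "f n ` simplices X n = simplices Y n" for n
    using bij by (simp add: bij_betw_def)
  have all: "(\<forall>y\<in>simplices Y n. P y) \<longleftrightarrow> (\<forall>x\<in>simplices X n. P (f n x))" for n P
    unfolding img[symmetric] by blast
  have Yface: "face Y n i (f n x) = f (n - 1) (face X n i x)"
    if "x \<in> simplices X n" "1 \<le> n" "i \<le> n" for n i x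
    using face that by simp
  have Ydegen: "degen Y n i (f n x) = f (n + 1) (degen X n i x)"
    if "x \<in> simplices X n" "i \<le> n" for n i x
    using degen that by simp
  have YfaceS: "face Y (n + 1) i (f (n + 1) x) = f n (face X (n + 1) i x)"
    if "x \<in> simplices X (n + 1)" "i \<le> n + 1" for n i x
    using face[of x "n + 1" i] that by simp
  have YdegenP: "degen Y (n - 1) i (f (n - 1) x) = f n (degen X (n - 1) i x)"
    if "x \<in> simplices X (n - 1)" "1 \<le> n" "i \<le> n - 1" for n i x
    using degen[of x "n - 1" i] that by simp
  have Y1: "face Y n i \<in> simplices Y n \<rightarrow> simplices Y (n - 1)" if "1 \<le> n" "i \<le> n" for n i
    unfolding Pi_def img[symmetric] using Yface Xface that by auto
  have Y2: "degen Y n i \<in> simplices Y n \<rightarrow> simplices Y (n + 1)" if "i \<le> n" for n i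
    unfolding Pi_def img[symmetric] using Ydegen Xdegen that by auto
  have "simplicial_set Y"
    unfolding simplicial_set_def all
  proof (intro conjI allI ballI impI; (elim conjE)?)
    fix n i j x assume h: "x \<in> simplices X n" "2 \<le> n" "i < j" "j \<le> n"
    have e: "face X (n - 1) i (face X n j x) = face X (n - 1) (j - 1) (face X n i x)"
      by (rule X_face_face) (use h in simp_all)
    have b: "1 \<le> n" "i \<le> n" "1 \<le> n - 1" "i \<le> n - 1" "j - 1 \<le> n - 1" using h by simp_all
    show "face Y (n - 1) i (face Y n j (f n x)) = face Y (n - 1) (j - 1) (face Y n i (f n x))"
      by (simp only: Yface[OF h(1) b(1) h(4)] Yface[OF h(1) b(1) b(2)]
          Yface[OF Xface[OF h(1) b(1) h(4)] b(3) b(4)]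
          Yface[OF Xface[OF h(1) b(1) b(2)] b(3) b(5)] e)
  next
    fix n i j x assume h: "x \<in> simplices X n" "i < j" "j \<le> n"
    have e: "face X (n + 1) i (degen X n j x) = degen X (n - 1) (j - 1) (face X n i x)"
      by (rule X_below) (use h in simp_all)
    have b: "1 \<le> n" "i \<le> n" "i \<le> n + 1" "j - 1 \<le> n - 1" using h by simp_all
    show "face Y (n + 1) i (degen Y n j (f n x)) = degen Y (n - 1) (j - 1) (face Y n i (f n x))"
      by (simp only: Ydegen[OF h(1,3)] Yface[OF h(1) b(1,2)]
          YfaceS[OF Xdegen[OF h(1,3)] b(3)] YdegenP[OF Xface[OF h(1) b(1,2)] b(1,4)] e)
  next
    fix n j x assume h: "x \<in> simplices X n" "j \<le> n"
    have e: "face X (n + 1) j (degen X n j x) = x" "face X (n + 1) (j + 1) (degen X n j x) = x"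
      using X_same[OF h(1,2)] by simp_all
    have b: "j \<le> n + 1" "j + 1 \<le> n + 1" using h by simp_all
    show "face Y (n + 1) j (degen Y n j (f n x)) = f n x"
      by (simp only: Ydegen[OF h] YfaceS[OF Xdegen[OF h] b(1)] e)
    show "face Y (n + 1) (j + 1) (degen Y n j (f n x)) = f n x"
      by (simp only: Ydegen[OF h] YfaceS[OF Xdegen[OF h] b(2)] e)
  next
    fix n i j x assume h: "x \<in> simplices X n" "j + 1 < i" "i \<le> n + 1"
    have e: "face X (n + 1) i (degen X n j x) = degen X (n - 1) j (face X n (i - 1) x)"
      by (rule X_above) (use h in simp_all)
    have b: "1 \<le> n" "i - 1 \<le> n" "j \<le> n" "j \<le> n - 1" using h by simp_all
    show "face Y (n + 1) i (degen Y n j (f n x)) = degen Y (n - 1) j (face Y n (i - 1) (f n x))"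
      by (simp only: Ydegen[OF h(1) b(3)] Yface[OF h(1) b(1,2)]
          YfaceS[OF Xdegen[OF h(1) b(3)] h(3)] YdegenP[OF Xface[OF h(1) b(1,2)] b(1,4)] e)
  next
    fix n i j x assume h: "x \<in> simplices X n" "i \<le> j" "j \<le> n"
    have e: "degen X (n + 1) i (degen X n j x) = degen X (n + 1) (j + 1) (degen X n i x)"
      by (rule X_degen_degen) (use h in simp_all)
    have b: "i \<le> n" "i \<le> n + 1" "j + 1 \<le> n + 1" using h by simp_all
    show "degen Y (n + 1) i (degen Y n j (f n x)) = degen Y (n + 1) (j + 1) (degen Y n i (f n x))"
      by (simp only: Ydegen[OF h(1,3)] Ydegen[OF h(1) b(1)]
          Ydegen[OF Xdegen[OF h(1,3)] b(2)] Ydegen[OF Xdegen[OF h(1) b(1)] b(3)] e)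
  qed (use Y1 Y2 in auto)
  then show ?thesis
    unfolding simplicial_iso_def using X bij face degen by blast
qed


section \<open>The monoid of subsets of a partial monoid\<close>

definition subset_monoid :: "'a set \<Rightarrow> ('a \<Rightarrow> 'a \<Rightarrow> 'a set) \<Rightarrow> 'a \<Rightarrow> 'a set monoid" where
  "subset_monoid M h e =
    \<lparr> carrier = Pow M, mult = (\<lambda>A B. \<Union>a\<in>A. \<Union>b\<in>B. h a b), one = {e} \<rparr>"

text \<open>
  The sum of a finite family, empty when that sum is undefined. Taking the product over an index
  set instead of a list makes splitting along disjoint unions immediate.
\<close>

definition hypersum_over ::
  "'a set \<Rightarrow> ('a \<Rightarrow> 'a \<Rightarrow> 'a set) \<Rightarrow> 'a \<Rightarrow> ('i \<Rightarrow> 'a) \<Rightarrow> 'i set \<Rightarrow> 'a set" where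
  "hypersum_over M h e m S = finprod (subset_monoid M h e) (\<lambda>i. {m i}) S"

context commutative_partial_monoid
begin

abbreviation "hsum_over \<equiv> hypersum_over M hsum e"

lemma hsum_eq_singleton:
  assumes "a \<in> M" "b \<in> M" "c \<in> a \<boxplus> b"
  shows "a \<boxplus> b = {c}"
  using hsum_deterministic[OF assms(1,2)] assms(3) by auto

text \<open>
  Associativity and commutativity pass from elements to subsets because the product of subsets is a
  union over their elements. The unit law uses determinism: in a general plasma \<open>e \<boxplus> a\<close> may contain
  more than \<open>a\<close>.
\<close>

lemma comm_monoid_subset_monoid: "comm_monoid (subset_monoid M hsum e)"
proof (rule comm_monoidI)
  fix A B C
  assume "A \<in> carrier (subset_monoid M hsum e)" "B \<in> carrier (subset_monoid M hsum e)"
    "C \<in> carrier (subset_monoid M hsum e)"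
  then have ABC: "A \<subseteq> M" "B \<subseteq> M" "C \<subseteq> M" by (auto simp: subset_monoid_def)
  have "(\<Union>x\<in>(\<Union>a\<in>A. \<Union>b\<in>B. a \<boxplus> b). \<Union>c\<in>C. x \<boxplus> c)
      = (\<Union>a\<in>A. \<Union>b\<in>B. \<Union>c\<in>C. \<Union>x\<in>a \<boxplus> b. x \<boxplus> c)" by blast
  also have "\<dots> = (\<Union>a\<in>A. \<Union>b\<in>B. \<Union>c\<in>C. \<Union>x\<in>b \<boxplus> c. a \<boxplus> x)"
    using ABC by (intro SUP_cong refl hsum_assoc) auto
  also have "\<dots> = (\<Union>a\<in>A. \<Union>x\<in>(\<Union>b\<in>B. \<Union>c\<in>C. b \<boxplus> c). a \<boxplus> x)" by blast
  finally show "A \<otimes>\<^bsub>subset_monoid M hsum e\<^esub> B \<otimes>\<^bsub>subset_monoid M hsum e\<^esub> C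
      = A \<otimes>\<^bsub>subset_monoid M hsum e\<^esub> (B \<otimes>\<^bsub>subset_monoid M hsum e\<^esub> C)"
    by (simp add: subset_monoid_def)
next
  fix A B
  assume "A \<in> carrier (subset_monoid M hsum e)" "B \<in> carrier (subset_monoid M hsum e)"
  then have AB: "A \<subseteq> M" "B \<subseteq> M" by (auto simp: subset_monoid_def)
  show "A \<otimes>\<^bsub>subset_monoid M hsum e\<^esub> B \<in> carrier (subset_monoid M hsum e)"
    using AB hsum_subset by (fastforce simp: subset_monoid_def)
  have "(\<Union>a\<in>A. \<Union>b\<in>B. a \<boxplus> b) = (\<Union>a\<in>A. \<Union>b\<in>B. b \<boxplus> a)"
    using AB by (intro SUP_cong refl hsum_commute) auto
  then show "A \<otimes>\<^bsub>subset_monoid M hsum e\<^esub> B = B \<otimes>\<^bsub>subset_monoid M hsum e\<^esub> A"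
    by (auto simp: subset_monoid_def)
next
  fix A assume "A \<in> carrier (subset_monoid M hsum e)"
  then have "e \<boxplus> a = {a}" if "a \<in> A" for a
    using that by (intro hsum_eq_singleton unit_mem unit_hsum) (auto simp: subset_monoid_def)
  then show "\<one>\<^bsub>subset_monoid M hsum e\<^esub> \<otimes>\<^bsub>subset_monoid M hsum e\<^esub> A = A"
    by (simp add: subset_monoid_def)
qed (simp add: subset_monoid_def unit_mem)

lemma hsum_over_empty: "hsum_over m {} = {e}"
  unfolding hypersum_over_def comm_monoid.finprod_empty[OF comm_monoid_subset_monoid]
  by (simp add: subset_monoid_def)

lemma hsum_over_Un:
  assumes "finite S" "finite T" "S \<inter> T = {}" "m ` (S \<union> T) \<subseteq> M"
  shows "hsum_over m (S \<union> T) = (\<Union>a\<in>hsum_over m S. \<Union>b\<in>hsum_over m T. a \<boxplus> b)"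
proof -
  have "(\<lambda>i. {m i}) \<in> S \<rightarrow> carrier (subset_monoid M hsum e)"
    "(\<lambda>i. {m i}) \<in> T \<rightarrow> carrier (subset_monoid M hsum e)"
    using assms(4) by (auto simp: subset_monoid_def)
  then show ?thesis
    using comm_monoid.finprod_Un_disjoint[OF comm_monoid_subset_monoid assms(1-3)]
    by (simp add: hypersum_over_def subset_monoid_def)
qed

lemma hsum_over_singleton:
  assumes "m i \<in> M"
  shows "hsum_over m {i} = {m i}"
proof -
  have "(\<lambda>i. {m i}) \<in> {} \<rightarrow> carrier (subset_monoid M hsum e)" by simp
  moreover have "{m i} \<in> carrier (subset_monoid M hsum e)"
    using assms by (simp add: subset_monoid_def)
  ultimately show ?thesis
    using comm_monoid.finprod_insert[OF comm_monoid_subset_monoid, of "{}" i "\<lambda>i. {m i}"]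
    by (simp add: hypersum_over_def comm_monoid.finprod_empty[OF comm_monoid_subset_monoid]
        monoid.r_one[OF comm_monoid.axioms(1)[OF comm_monoid_subset_monoid]])
qed

lemma hsum_over_insert:
  assumes "finite S" "i \<notin> S" "m ` insert i S \<subseteq> M"
  shows "hsum_over m (insert i S) = (\<Union>b\<in>hsum_over m S. b \<boxplus> m i)"
  using hsum_over_Un[of S "{i}" m] hsum_over_singleton[of m i] assms by simp

lemma hsum_over_cong:
  assumes "\<And>i. i \<in> S \<Longrightarrow> m i = m' i" "m' ` S \<subseteq> M"
  shows "hsum_over m S = hsum_over m' S"
  unfolding hypersum_over_def
  using assms by (intro comm_monoid.finprod_cong'[OF comm_monoid_subset_monoid])
    (auto simp: subset_monoid_def)

lemma hsum_over_cases:
  assumes "finite S" "m ` S \<subseteq> M"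
  shows "hsum_over m S = {} \<or> (\<exists>c\<in>M. hsum_over m S = {c})"
  using assms
proof (induction S rule: finite_induct)
  case empty
  then show ?case using unit_mem by (simp add: hsum_over_empty)
next
  case (insert i S)
  then consider "hsum_over m S = {}" | c where "c \<in> M" "hsum_over m S = {c}" by auto
  then show ?case
  proof cases
    case 2
    then show ?thesis
      using insert hsum_deterministic[of c "m i"] hsum_subset[of c "m i"] hsum_over_insert[of S i m]
      by auto
  qed (use insert hsum_over_insert[of S i m] in simp)
qed

text \<open>
  The empty set is absorbing, so an undefined subsum would make the whole sum undefined.
\<close>

lemma hsum_over_subset_defined:
  assumes "finite S" "T \<subseteq> S" "m ` S \<subseteq> M" "hsum_over m S \<noteq> {}"
  obtains c where "c \<in> M" "hsum_over m T = {c}"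
proof -
  have "finite T" "finite (S - T)" "T \<union> (S - T) = S" "m ` T \<subseteq> M"
    using assms by (auto intro: finite_subset)
  then have "hsum_over m T \<noteq> {}"
    using hsum_over_Un[of T "S - T" m] assms(3,4) by auto
  then show thesis
    using hsum_over_cases[OF \<open>finite T\<close> \<open>m ` T \<subseteq> M\<close>] that by blast
qed

text \<open>
  A left-bracketed hypersum grows at its right end, hence the induction from the back. The shift
  \<open>i - 1\<close> matches the list positions with the index set \<open>{1..n}\<close> of \<open>Hhat\<close>.
\<close>

lemma iterated_hsum_eq_hsum_over:
  assumes "set ms \<subseteq> M"
  shows "iterated_hsum hsum e ms = hsum_over (\<lambda>i. ms ! (i - 1)) {1..length ms}"
  using assms
proof (induction ms rule: rev_induct)
  case Nil
  then show ?case by (simp add: hsum_over_empty)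
next
  case (snoc b ms)
  have mem: "ms ! (i - 1) \<in> M" if "i \<in> {1..length ms}" for i
  proof -
    have "i - 1 < length ms" using that by auto
    then show ?thesis using nth_mem snoc.prems by fastforce
  qed
  have range_snoc: "{1..length (ms @ [b])} = insert (Suc (length ms)) {1..length ms}" by auto
  have "hsum_over (\<lambda>i. (ms @ [b]) ! (i - 1)) {1..length ms}
      = hsum_over (\<lambda>i. ms ! (i - 1)) {1..length ms}"
    using mem by (intro hsum_over_cong) (auto simp: nth_append)
  moreover have "(\<lambda>i. (ms @ [b]) ! (i - 1)) ` insert (Suc (length ms)) {1..length ms} \<subseteq> M"
    using mem snoc.prems by (auto simp: nth_append)
  then have "hsum_over (\<lambda>i. (ms @ [b]) ! (i - 1)) (insert (Suc (length ms)) {1..length ms})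
      = (\<Union>x\<in>hsum_over (\<lambda>i. (ms @ [b]) ! (i - 1)) {1..length ms}. x \<boxplus> b)"
    using hsum_over_insert[of "{1..length ms}" "Suc (length ms)" "\<lambda>i. (ms @ [b]) ! (i - 1)"] by simp
  ultimately have "hsum_over (\<lambda>i. (ms @ [b]) ! (i - 1)) {1..length (ms @ [b])}
      = (\<Union>x\<in>iterated_hsum hsum e ms. x \<boxplus> b)"
    unfolding range_snoc using snoc by simp
  \<comment> \<open>For empty \<open>ms\<close> this is \<open>e \<boxplus> b = {b}\<close>: a hypersum of one term does not start from the unit.\<close>
  also have "\<dots> = iterated_hsum hsum e (ms @ [b])"
    using snoc.prems unit_mem unit_hsum[of b] hsum_eq_singleton[of e b b] by (cases ms) auto
  finally show ?case by simp
qed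


section \<open>Additive families of subset sums\<close>

lemma Hhat_mem: "x \<in> F1_set (Hhat M hsum e) n \<Longrightarrow> S \<subseteq> {1..n} \<Longrightarrow> x S \<in> M"
  by (auto simp: Hhat_def)

lemma Hhat_hsum:
  assumes "x \<in> F1_set (Hhat M hsum e) n" "S \<subseteq> {1..n}" "T \<subseteq> {1..n}" "S \<inter> T = {}"
  shows "x S \<boxplus> x T = {x (S \<union> T)}"
proof (rule hsum_eq_singleton)
  show "x (S \<union> T) \<in> x S \<boxplus> x T"
    using assms unfolding Hhat_def F1_data.simps by blast
qed (use assms Hhat_mem in blast)+

text \<open>
  Adding the points of \<open>S\<close> one at a time, additivity and determinism force the value at each step.
  Hence the values on singletons determine the family (injectivity of the comparison map), and their
  sum over \<open>{1..n}\<close> is defined (the comparison map lands in the bar construction).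
\<close>

lemma Hhat_eq_hsum_over:
  assumes x: "x \<in> F1_set (Hhat M hsum e) n" and S: "S \<subseteq> {1..n}"
  shows "hsum_over (\<lambda>i. x {i}) S = {x S}"
proof -
  have "finite S" using S finite_subset by blast
  then show ?thesis
    using S
  proof (induction S rule: finite_induct)
    case empty
    then show ?case using x by (simp add: hsum_over_empty Hhat_def)
  next
    case (insert i S)
    then have "x S \<boxplus> x {i} = {x (insert i S)}"
      using Hhat_hsum[OF x, of S "{i}"] by simp
    moreover have "(\<lambda>i. x {i}) ` insert i S \<subseteq> M"
      using insert.prems Hhat_mem[OF x] by auto
    ultimately show ?case
      using hsum_over_insert[of S i "\<lambda>i. x {i}"] insert by auto
  qed
qed

text \<open>This gives the surjectivity of the comparison map.\<close>

lemma subset_sums_in_Hhat: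
  assumes m: "m ` {1..n} \<subseteq> M" and def: "hsum_over m {1..n} \<noteq> {}"
  shows "(\<lambda>S\<in>Pow {1..n}. the_elem (hsum_over m S)) \<in> F1_set (Hhat M hsum e) n"
proof -
  define c where "c S = the_elem (hsum_over m S)" for S
  have val: "c S \<in> M" "hsum_over m S = {c S}" if S: "S \<subseteq> {1..n}" for S
  proof -
    obtain d where "d \<in> M" "hsum_over m S = {d}"
      using hsum_over_subset_defined[OF finite_atLeastAtMost S m def] .
    then show "c S \<in> M" "hsum_over m S = {c S}" by (simp_all add: c_def)
  qed
  have "c (S \<union> T) \<in> c S \<boxplus> c T" if "S \<subseteq> {1..n}" "T \<subseteq> {1..n}" "S \<inter> T = {}" for S T
  proof -
    have "finite S" "finite T"
      using that by (auto intro: finite_subset)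
    moreover have "m ` (S \<union> T) \<subseteq> M"
      using that m by blast
    ultimately have "hsum_over m (S \<union> T) = (\<Union>a\<in>hsum_over m S. \<Union>b\<in>hsum_over m T. a \<boxplus> b)"
      using that by (intro hsum_over_Un)
    then have "{c (S \<union> T)} = c S \<boxplus> c T"
      using that by (simp add: val)
    then show ?thesis by blast
  qed
  moreover have "c {} = e"
    by (simp add: c_def hsum_over_empty)
  ultimately have "(\<lambda>S\<in>Pow {1..n}. c S) \<in> F1_set (Hhat M hsum e) n"
    using val(1) unfolding Hhat_def F1_data.simps by (simp add: restrict_PiE_iff)
  then show ?thesis by (simp add: c_def)
qed

lemma bij_betw_Hhat_BM:
  "bij_betw (\<lambda>x. map (\<lambda>i. x {i}) [1..<n+1]) (F1_set (Hhat M hsum e) n) (simplices (BM M hsum e) n)"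
proof (rule bij_betw_imageI)
  show "inj_on (\<lambda>x. map (\<lambda>i. x {i}) [1..<n+1]) (F1_set (Hhat M hsum e) n)"
  proof (rule inj_onI)
    fix x y
    assume x: "x \<in> F1_set (Hhat M hsum e) n" and y: "y \<in> F1_set (Hhat M hsum e) n"
      and eq: "map (\<lambda>i. x {i}) [1..<n+1] = map (\<lambda>i. y {i}) [1..<n+1]"
    have "x S = y S" if S: "S \<subseteq> {1..n}" for S
    proof -
      have "x {i} = y {i}" if "i \<in> S" for i
        using eq S that by (auto simp del: upt_Suc simp flip: atLeastLessThanSuc_atLeastAtMost)
      moreover have "(\<lambda>i. y {i}) ` S \<subseteq> M"
        using y S by (auto simp: Hhat_def)
      ultimately have "hsum_over (\<lambda>i. x {i}) S = hsum_over (\<lambda>i. y {i}) S"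
        by (intro hsum_over_cong)
      then show ?thesis
        using Hhat_eq_hsum_over[OF x S] Hhat_eq_hsum_over[OF y S] by simp
    qed
    then show "x = y"
      using x y by (intro PiE_ext[of x "Pow {1..n}" "\<lambda>_. M" y]) (auto simp: Hhat_def)
  qed
next
  show "(\<lambda>x. map (\<lambda>i. x {i}) [1..<n+1]) ` F1_set (Hhat M hsum e) n = simplices (BM M hsum e) n"
  proof (intro equalityI subsetI)
    fix ms assume "ms \<in> (\<lambda>x. map (\<lambda>i. x {i}) [1..<n+1]) ` F1_set (Hhat M hsum e) n"
    then obtain x where x: "x \<in> F1_set (Hhat M hsum e) n" and ms: "ms = map (\<lambda>i. x {i}) [1..<n+1]"
      by auto
    have xM: "x {i} \<in> M" if "i \<in> {1..n}" for i
      using x that by (auto simp: Hhat_def)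
    have len: "length ms = n" and sub: "set ms \<subseteq> M"
      using ms xM by auto
    have nth: "ms ! (i - 1) = x {i}" if "i \<in> {1..n}" for i
      using that by (auto simp: ms nth_append simp del: upt_Suc)
    have "hsum_over (\<lambda>i. ms ! (i - 1)) {1..n} = hsum_over (\<lambda>i. x {i}) {1..n}"
      using nth xM by (intro hsum_over_cong) auto
    then have "iterated_hsum hsum e ms = {x {1..n}}"
      using iterated_hsum_eq_hsum_over[OF sub] Hhat_eq_hsum_over[OF x] len by simp
    then show "ms \<in> simplices (BM M hsum e) n"
      using len sub by (simp add: BM_def sum_defined_def)
  next
    fix ms assume "ms \<in> simplices (BM M hsum e) n"
    then have len: "length ms = n" and sub: "set ms \<subseteq> M" and def: "iterated_hsum hsum e ms \<noteq> {}"
      by (auto simp: BM_def sum_defined_def)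
    define m where "m = (\<lambda>i. ms ! (i - 1))"
    have mM: "m i \<in> M" if "i \<in> {1..n}" for i
    proof -
      have "i - 1 < length ms" using that len by auto
      then show ?thesis unfolding m_def using nth_mem sub by blast
    qed
    have "hsum_over m {1..n} \<noteq> {}"
      using def iterated_hsum_eq_hsum_over[OF sub] len by (simp add: m_def)
    then have "(\<lambda>S\<in>Pow {1..n}. the_elem (hsum_over m S)) \<in> F1_set (Hhat M hsum e) n"
      using mM by (intro subset_sums_in_Hhat) auto
    moreover have "ms = map (\<lambda>i. (\<lambda>S\<in>Pow {1..n}. the_elem (hsum_over m S)) {i}) [1..<n+1]"
    proof (rule nth_equalityI)
      fix k assume "k < length ms"
      then have k: "k < n" using len by simp
      then have "hsum_over m {Suc k} = {ms ! k}"
        using hsum_over_singleton[of m "Suc k"] mM[of "Suc k"] by (simp add: m_def)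
      then show "ms ! k = map (\<lambda>i. (\<lambda>S\<in>Pow {1..n}. the_elem (hsum_over m S)) {i}) [1..<n+1] ! k"
        using k by (simp del: upt_Suc)
    qed (simp add: len)
    ultimately show "ms \<in> (\<lambda>x. map (\<lambda>i. x {i}) [1..<n+1]) ` F1_set (Hhat M hsum e) n"
      by blast
  qed
qed

end


section \<open>Faces and degeneracies\<close>

text \<open>
  The pointed map \<open>beta m n \<phi>\<close> cuts \<open>{1..n}\<close> at the values of \<open>\<phi>\<close>; its fibre over \<open>j\<close> is the block
  between two consecutive cuts.
\<close>

lemma beta_vimage_singleton:
  assumes "\<phi> \<in> Delta_hom m n" "j \<in> {1..m}"
  shows "beta m n \<phi> -` {j} \<inter> {0..n} = {\<phi> (j - 1)<..\<phi> j}"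
proof -
  have "\<phi> j \<le> n" using assms by (auto simp: Delta_hom_def)
  moreover have "beta m n \<phi> 0 = 0" by (simp add: beta_def)
  then have "beta m n \<phi> i = j \<longleftrightarrow> i \<in> {1..n} \<and> i \<le> \<phi> j \<and> \<phi> (j - 1) < i" if "i \<le> n" for i
    using that assms(2) beta_eq_iff[OF assms(1) _ assms(2), of i] by (cases "i = 0") auto
  ultimately show ?thesis by fastforce
qed

lemma Hhat_act_beta_singleton:
  assumes "\<phi> \<in> Delta_hom m n" "j \<in> {1..m}"
  shows "F1_act (Hhat M h e) n m (beta m n \<phi>) x {j} = x {\<phi> (j - 1)<..\<phi> j}"
  using beta_vimage_singleton[OF assms] assms(2) by (simp add: Hhat_def)

context commutative_partial_monoid
begin

text \<open>
  The blocks of \<open>coface n i\<close> cover all of \<open>{1..n}\<close> when \<open>0 < i < n\<close>, with \<open>i\<close> and \<open>i + 1\<close> in one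
  block. For \<open>i = 0\<close> and \<open>i = n\<close> all blocks are singletons and the first or last point is lost to the
  basepoint, which is why the outer faces drop an entry.
\<close>

lemma Hhat_face:
  assumes x: "x \<in> F1_set (Hhat M hsum e) n" and n: "1 \<le> n" and i: "i \<le> n"
  shows "map (\<lambda>j. F1_act (Hhat M hsum e) n (n - 1) (beta (n - 1) n (coface n i)) x {j}) [1..<n - 1 + 1]
    = face (BM M hsum e) n i (map (\<lambda>j. x {j}) [1..<n + 1])"
    (is "?L = ?R")
proof (rule nth_equalityI)
  show "length ?L = length ?R"
    using n i by (auto simp: BM_def simp del: upt_Suc)
next
  fix k assume "k < length ?L"
  then have k: "k < n - 1" by (simp del: upt_Suc)
  have "?L ! k = x {coface n i k<..coface n i (Suc k)}"
    using k Hhat_act_beta_singleton[OF coface_Delta_hom[OF n i], of "Suc k"] by (simp del: upt_Suc)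
  also have "{coface n i k<..coface n i (Suc k)}
      = (if Suc k < i then {Suc k} else if Suc k = i then {i, Suc i} else {Suc (Suc k)})"
    using k by (auto simp: coface_def)
  also have "x \<dots> = ?R ! k"
  proof (cases "Suc k = i")
    case True
    then have "x {i} \<boxplus> x {Suc i} = {x {i, Suc i}}"
      using Hhat_hsum[OF x, of "{i}" "{Suc i}"] k by (simp add: insert_commute)
    then show ?thesis
      using True k by (auto simp: BM_def nth_append partial_sum_def simp del: upt_Suc)
  next
    case False
    then show ?thesis
      using k i by (auto simp: BM_def nth_append nth_tl nth_butlast simp del: upt_Suc)
  qed
  finally show "?L ! k = ?R ! k" .
qed

text \<open>
  The value \<open>i\<close> is taken at \<open>i\<close> and \<open>i + 1\<close>, so the block over \<open>i + 1\<close> is empty and contributes the unit.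
\<close>

lemma Hhat_degen:
  assumes x: "x \<in> F1_set (Hhat M hsum e) n" and i: "i \<le> n"
  shows "map (\<lambda>j. F1_act (Hhat M hsum e) n (n + 1) (beta (n + 1) n (codegen n i)) x {j}) [1..<n + 1 + 1]
    = degen (BM M hsum e) n i (map (\<lambda>j. x {j}) [1..<n + 1])"
    (is "?L = ?R")
proof (rule nth_equalityI)
  show "length ?L = length ?R"
    using i by (auto simp: BM_def simp del: upt_Suc)
next
  fix k assume "k < length ?L"
  then have k: "k < n + 1" by (simp del: upt_Suc)
  have "?L ! k = x {codegen n i k<..codegen n i (Suc k)}"
    using k Hhat_act_beta_singleton[OF codegen_Delta_hom[OF i], of "Suc k"] by (simp del: upt_Suc)
  also have "{codegen n i k<..codegen n i (Suc k)}
      = (if k < i then {Suc k} else if k = i then {} else {k})"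
    using k by (auto simp: codegen_def)
  also have "x \<dots> = ?R ! k"
    using x k i by (auto simp: BM_def Hhat_def nth_append simp del: upt_Suc)
  finally show "?L ! k = ?R ! k" .
qed

end

theorem proposition4p19:
  fixes M :: "'a set" and hsum :: "'a \<Rightarrow> 'a \<Rightarrow> 'a set" and e :: 'a
  assumes "commutative_partial_monoid M hsum e"
  shows "simplicial_iso
    (simplicial_of_presheaf (B_presheaf (Hhat M hsum e)))
    (BM M hsum e)
    (\<lambda>n x. map (\<lambda>i. x {i}) [1..<n+1])"
proof -
  interpret commutative_partial_monoid M hsum e by (rule assms)
  have "simplicial_set (simplicial_of_presheaf (B_presheaf (Hhat M hsum e)))"
    by (intro simplicial_set_of_presheaf B_presheaf_functor Hhat_F1_module) simp
  then show ?thesis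
    by (rule simplicial_iso_transport)
      (simp_all only: simplicial_of_presheaf_def B_presheaf_def simplicial_data.simps
        presheaf_data.simps bij_betw_Hhat_BM Hhat_face Hhat_degen)
qed

end
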